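(* For $n, m \in \mathbb{N}$, let $kr_3(n,m)$ be the number of partitions $\lambda_1 \le \lambda_2 \le \cdots \le \lambda_m$ of $n$ into $m$ parts with smallest part at least three, and difference at least three at distance two, such that if two successive parts differ by at most one, then their sum is divisible by three. Then $$\sum_{n, m \geq 0} kr_3(n, m)\, q^n x^m = \sum_{n_1, n_2 \geq 0} \frac{ q^{3n_2^2 + 3n_2 + n_1^2 + 2n_1 + 3n_1n_2}\, x^{2n_2 + n_1} }{ (q; q)_{n_1} (q^3; q^3)_{n_2} }.$$
   Context: $\mathbb{N}=\{0,1,2,\dots\}$. A partition of $n$ into $m$ parts is a non-decreasing sequence $\lambda_1 \le \cdots \le \lambda_m$ of positive integers with sum $n$ (the empty partition is the unique partition of $0$, with $m=0$; it satisfies all the conditions vacuously). "Difference at least $k$ at distance $d$" means $\lambda_{j+d}-\lambda_j \ge k$ for all $1 \le j \le m-d$. "Successive parts" are $\lambda_j$ and $\lambda_{j+1}$. The $q$-Pochhammer symbol is $(a;q)_n = \prod_{j=1}^{n}(1-aq^{j-1})$, with $(a;q)_0=1$. The identity is one of formal power series in $q$ and $x$. *)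

theory Defs
  imports
    "HOL-Analysis.Infinite_Sum"
    "HOL-Computational_Algebra.Formal_Power_Series"
begin

definition partition_into :: "nat \<Rightarrow> nat \<Rightarrow> nat list \<Rightarrow> bool" where
  "partition_into n m ps \<longleftrightarrow>
     length ps = m \<and> sum_list ps = n \<and> sorted ps \<and> (\<forall>p\<in>set ps. 0 < p)"

text \<open>
  Differences of parts are written additively, since subtraction on \<^typ>\<open>nat\<close> truncates.
  List indices start at 0.
\<close>

definition diff_at_distance :: "nat \<Rightarrow> nat \<Rightarrow> nat list \<Rightarrow> bool" where
  "diff_at_distance k d ps \<longleftrightarrow>
     (\<forall>j. j + d < length ps \<longrightarrow> ps ! j + k \<le> ps ! (j + d))"

definition close_parts_sum_dvd :: "nat \<Rightarrow> nat list \<Rightarrow> bool" where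
  "close_parts_sum_dvd k ps \<longleftrightarrow>
     (\<forall>j. j + 1 < length ps \<longrightarrow> ps ! (j + 1) \<le> ps ! j + 1 \<longrightarrow>
        k dvd ps ! j + ps ! (j + 1))"

definition kr3 :: "nat \<Rightarrow> nat \<Rightarrow> nat" where
  "kr3 n m = card {ps. partition_into n m ps \<and> (\<forall>p\<in>set ps. 3 \<le> p) \<and>
     diff_at_distance 3 2 ps \<and> close_parts_sum_dvd 3 ps}"

definition qpochhammer :: "'a::comm_ring_1 \<Rightarrow> 'a \<Rightarrow> nat \<Rightarrow> 'a" where
  "qpochhammer a q n = (\<Prod>j=1..n. 1 - a * q ^ (j - 1))"

text \<open>
  Formal power series in \<open>q\<close> and \<open>x\<close> are power series in \<open>q\<close> whose coefficients are power
  series in \<open>x\<close>.  Infinite sums are taken in the topology of \<^typ>\<open>rat fps fps\<close>, which is the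
  \<open>q\<close>-adic one with discrete coefficients; so \<open>q\<close> has to be the outer variable.  In the sums
  considered here only finitely many terms contribute to a given power of \<open>q\<close>, but
  infinitely many may contribute to a given power of \<open>x\<close>.
\<close>

definition q_var :: "rat fps fps" where "q_var = fps_X"

definition x_var :: "rat fps fps" where "x_var = fps_const fps_X"

text \<open>
  The coefficient ring \<^typ>\<open>rat fps\<close> is not a field, but \<^term>\<open>f / g\<close> is still the genuine
  quotient when \<open>g\<close> has constant coefficient 1, as \<open>q\<close>-Pochhammer symbols do.
\<close>

lemma fps_divide_mult_const_1:
  fixes f g :: "rat fps fps"
  assumes "fps_nth g 0 = 1"
  shows "f / g * g = f"
proof -
  have "subdegree g = 0"
    using assms by (simp add: subdegree_eq_0_iff)
  moreover have "inverse g * g = 1"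
    using assms fps_right_inverse[of g 1] by (simp add: fps_inverse_def[of g] mult.commute)
  ultimately show ?thesis
    by (simp add: fps_divide_def mult.assoc)
qed

lemma qpochhammer_const_1:
  assumes "0 < k"
  shows "fps_nth (qpochhammer (q_var ^ k) (q_var ^ k) n) 0 = 1"
proof -
  have "fps_nth (\<Prod>j\<in>A. 1 - q_var ^ k * (q_var ^ k) ^ (j - 1)) 0 = 1" for A :: "nat set"
    using assms by (induction A rule: infinite_finite_induct) (simp_all add: q_var_def power_0_left)
  then show ?thesis
    by (simp add: qpochhammer_def)
qed

end

theory Submission
  imports Defs "HOL-Analysis.Elementary_Metric_Spaces"
begin

text \<open>
  Let \<open>P k\<close> be the generating function of those partitions that satisfy the difference and
  divisibility conditions and have all parts at least \<open>k\<close>, so that the left-hand side of the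
  identity is \<open>P 3\<close>.  If \<open>k\<close> is a part, then the conditions leave few possibilities for the part
  that follows it, and they depend only on \<open>k mod 3\<close>.  Removing the smallest part, together with the
  next part if that one is too close to be treated as free, gives
  \<open>P (3j+3) = P (3j+4) + x q^(3j+3) P (3j+5) + x^2 q^(6j+6) P (3j+6)\<close>,
  \<open>P (3j+4) = P (3j+5) + x q^(3j+4) P (3j+7) + x^2 q^(6j+9) P (3j+7) + x^2 q^(6j+10) P (3j+8)\<close>,
  \<open>P (3j+5) = P (3j+6) + x q^(3j+5) P (3j+7)\<close>.

  On the other side, put two parameters into the double series:
  \<open>G a b\<close> is the sum over \<open>n1\<close> and \<open>n2\<close> of
  \<open>q^(3 n2^2 + b n2 + n1^2 + a n1 + 3 n1 n2) x^(2 n2 + n1) / ((q; q)_n1 (q^3; q^3)_n2)\<close>.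
  Replacing \<open>a\<close> by \<open>a + 1\<close> multiplies a term by \<open>q^n1\<close>, and in the difference of the two series
  the factor \<open>1 - q^n1\<close> cancels the last factor of \<open>(q; q)_n1\<close>; in the same way \<open>b + 3\<close> is
  linked to \<open>(q^3; q^3)_n2\<close>.  This yields
  \<open>G a b = G (a+1) b + x q^(a+1) G (a+2) (b+3)\<close> and
  \<open>G a b = G a (b+3) + x^2 q^(b+3) G (a+3) (b+6)\<close>.
  From these two rules, the series \<open>G (3j+2) (6j+3)\<close>, \<open>G (3j+3) (6j+6)\<close>, \<open>G (3j+4) (6j+9)\<close>
  satisfy the same system as \<open>P (3j+3)\<close>, \<open>P (3j+4)\<close>, \<open>P (3j+5)\<close>.

  The system has only one solution (\<open>kr_system_unique\<close>): it expresses the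
  coefficient of \<open>q^n\<close> in \<open>P k\<close> by the one in \<open>P (k+1)\<close> and by coefficients of smaller powers of
  \<open>q\<close>, and for large \<open>k\<close> the coefficient of \<open>q^n\<close> is known.  Hence \<open>P 3 = G 2 3\<close>, which is the claim.  The two halves are
  \<open>kr_system_gf\<close> and \<open>kr_system_series\<close>.
\<close>

section \<open>Formal power series as a topological ring\<close>

text \<open>
  Convergence of power series means that each coefficient is eventually constant, so continuity of
  the ring operations amounts to the fact that a coefficient of \<open>f + g\<close> or \<open>f * g\<close> depends on
  finitely many coefficients of \<open>f\<close> and \<open>g\<close>.  With these instances the general rules for
  disjoint unions, scalar multiples and regrouping of infinite sums apply to power series.
\<close>

instance fps :: (ab_group_add) topological_comm_monoid_add
proof
  fix a b :: "'a fps"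
  have "filterlim fst (nhds a) (nhds a \<times>\<^sub>F nhds b)" "filterlim snd (nhds b) (nhds a \<times>\<^sub>F nhds b)"
    by (rule filterlim_fst filterlim_snd)+
  then have "\<forall>\<^sub>F z in nhds a \<times>\<^sub>F nhds b. fps_nth (fst z) n = fps_nth a n"
    and "\<forall>\<^sub>F z in nhds a \<times>\<^sub>F nhds b. fps_nth (snd z) n = fps_nth b n" for n
    by (auto simp: tendsto_fps_iff)
  then have "\<forall>\<^sub>F z in nhds a \<times>\<^sub>F nhds b. fps_nth (fst z + snd z) n = fps_nth (a + b) n" for n
    by (rule eventually_elim2[where P = "\<lambda>z. fps_nth (fst z) n = fps_nth a n"
          and Q = "\<lambda>z. fps_nth (snd z) n = fps_nth b n"]) auto
  then show "((\<lambda>z. fst z + snd z) \<longlongrightarrow> a + b) (nhds a \<times>\<^sub>F nhds b)"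
    by (rule tendsto_fpsI)
qed

instance fps :: (ring) topological_semigroup_mult
proof
  fix a b :: "'a fps"
  let ?F = "nhds a \<times>\<^sub>F nhds b"
  have "filterlim fst (nhds a) ?F" "filterlim snd (nhds b) ?F"
    by (rule filterlim_fst filterlim_snd)+
  then have ev: "\<forall>\<^sub>F z in ?F. fps_nth (fst z) i = fps_nth a i"
    "\<forall>\<^sub>F z in ?F. fps_nth (snd z) i = fps_nth b i" for i
    by (auto simp: tendsto_fps_iff)
  have "\<forall>\<^sub>F z in ?F. fps_nth (fst z * snd z) n = fps_nth (a * b) n" for n
  proof -
    have "\<forall>\<^sub>F z in ?F. \<forall>i\<in>{..n}. fps_nth (fst z) i = fps_nth a i \<and> fps_nth (snd z) i = fps_nth b i"
      by (rule eventually_ball_finite) (auto intro: ev eventually_conj)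
    then show ?thesis
      by eventually_elim (auto simp: fps_mult_nth intro!: sum.cong)
  qed
  then show "((\<lambda>z. fst z * snd z) \<longlongrightarrow> a * b) ?F"
    by (rule tendsto_fpsI)
qed

lemma fps_nth_q_power_mult_cong:
  assumes "\<And>m. m < n \<Longrightarrow> fps_nth f m = fps_nth g m" and "0 < i"
  shows "fps_nth (q_var ^ i * c * f) n = fps_nth (q_var ^ i * c * g) n"
  using assms
  by (auto simp: q_var_def mult.assoc fps_X_power_mult_nth fps_mult_nth intro!: sum.cong)

section \<open>A triangular system with a unique solution\<close>

text \<open>
  The coefficient condition at the end is the boundary condition: a nonempty partition into parts
  \<open>\<ge> k\<close> has sum at least \<open>k\<close>.  The margin of one in \<open>n + 1 < k\<close> comes from the double
  series, whose first parameter will be \<open>k - 1\<close>.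
\<close>

definition kr_system :: "(nat \<Rightarrow> rat fps fps) \<Rightarrow> bool" where
  "kr_system F \<longleftrightarrow>
     (\<forall>j. F (3*j+3) = F (3*j+4) + q_var^(3*j+3) * x_var * F (3*j+5)
            + q_var^(6*j+6) * x_var^2 * F (3*j+6)) \<and>
     (\<forall>j. F (3*j+4) = F (3*j+5) + q_var^(3*j+4) * x_var * F (3*j+7)
            + q_var^(6*j+9) * x_var^2 * F (3*j+7) + q_var^(6*j+10) * x_var^2 * F (3*j+8)) \<and>
     (\<forall>j. F (3*j+5) = F (3*j+6) + q_var^(3*j+5) * x_var * F (3*j+7)) \<and>
     (\<forall>k n. 3 \<le> k \<longrightarrow> n + 1 < k \<longrightarrow> fps_nth (F k) n = (if n = 0 then 1 else 0))"

text \<open>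
  Compare the coefficients of \<open>q^n\<close> by induction on \<open>n\<close>.  Every summand of the equations other
  than the first one carries a positive power of \<open>q\<close>, so its coefficient is determined by the
  induction hypothesis.  Thus agreement at \<open>k + 1\<close> implies agreement at \<open>k\<close>, and one can descend
  to \<open>k\<close> from a value so large that the boundary condition applies.
\<close>

lemma kr_system_unique:
  assumes F: "kr_system F" and G: "kr_system G" and "3 \<le> k"
  shows "F k = G k"
proof -
  have "\<forall>k\<ge>3. fps_nth (F k) n = fps_nth (G k) n" for n
  proof (induction n rule: less_induct)
    case (less n)
    have coeff_eq: "fps_nth (F k) n = fps_nth (G k) n"
      if k: "3 \<le> k" and Suc: "fps_nth (F (Suc k)) n = fps_nth (G (Suc k)) n" for k
    proof -
      have lower: "fps_nth (q_var ^ i * c * F l) n = fps_nth (q_var ^ i * c * G l) n"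
        if "0 < i" "3 \<le> l" for i c l
        by (rule fps_nth_q_power_mult_cong) (use less that in auto)
      have "\<exists>j. k = 3*j+3 \<or> k = 3*j+4 \<or> k = 3*j+5"
        using k by presburger
      then obtain j where "k = 3*j+3 \<or> k = 3*j+4 \<or> k = 3*j+5" by blast
      then consider "k = 3*j+3" | "k = 3*j+4" | "k = 3*j+5" by blast
      then show ?thesis
      proof cases
        case 1
        have eqn: "H (3*j+3) = H (3*j+4) + q_var^(3*j+3) * x_var * H (3*j+5)
            + q_var^(6*j+6) * x_var^2 * H (3*j+6)" if "kr_system H" for H
          using that unfolding kr_system_def by blast
        show ?thesis
          unfolding 1 eqn[OF F] eqn[OF G] fps_add_nth using Suc 1
          by (intro arg_cong2[where f = "(+)"] lower) (auto simp: eval_nat_numeral)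
      next
        case 2
        have eqn: "H (3*j+4) = H (3*j+5) + q_var^(3*j+4) * x_var * H (3*j+7)
            + q_var^(6*j+9) * x_var^2 * H (3*j+7) + q_var^(6*j+10) * x_var^2 * H (3*j+8)"
          if "kr_system H" for H
          using that unfolding kr_system_def by blast
        show ?thesis
          unfolding 2 eqn[OF F] eqn[OF G] fps_add_nth using Suc 2
          by (intro arg_cong2[where f = "(+)"] lower) (auto simp: eval_nat_numeral)
      next
        case 3
        have eqn: "H (3*j+5) = H (3*j+6) + q_var^(3*j+5) * x_var * H (3*j+7)"
          if "kr_system H" for H
          using that unfolding kr_system_def by blast
        show ?thesis
          unfolding 3 eqn[OF F] eqn[OF G] fps_add_nth using Suc 3
          by (intro arg_cong2[where f = "(+)"] lower) (auto simp: eval_nat_numeral)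
      qed
    qed
    show ?case
    proof (intro allI impI)
      fix k :: nat assume k: "3 \<le> k"
      have "k \<le> k + n + 2" by simp
      then show "fps_nth (F k) n = fps_nth (G k) n"
      proof (induction k rule: inc_induct)
        case base
        show ?case using F G k by (auto simp: kr_system_def)
      next
        case (step l)
        show ?case by (rule coeff_eq) (use k step in auto)
      qed
    qed
  qed
  with \<open>3 \<le> k\<close> show ?thesis by (intro fps_ext) auto
qed

section \<open>The double series\<close>

definition kr_denom :: "nat \<Rightarrow> nat \<Rightarrow> rat fps fps" where
  "kr_denom n1 n2 = qpochhammer q_var q_var n1 * qpochhammer (q_var ^ 3) (q_var ^ 3) n2"

definition kr_term :: "nat \<Rightarrow> nat \<Rightarrow> nat \<times> nat \<Rightarrow> rat fps fps" where
  "kr_term a b = (\<lambda>(n1, n2).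
     q_var ^ (3 * n2\<^sup>2 + b * n2 + n1\<^sup>2 + a * n1 + 3 * n1 * n2) * x_var ^ (2 * n2 + n1) /
       kr_denom n1 n2)"

definition kr_series :: "nat \<Rightarrow> nat \<Rightarrow> rat fps fps" where
  "kr_series a b = infsum (kr_term a b) UNIV"

lemma kr_denom_const_1: "fps_nth (kr_denom n1 n2) 0 = 1"
  using qpochhammer_const_1[of 1 n1] qpochhammer_const_1[of 3 n2] by (simp add: kr_denom_def)

text \<open>
  This and the following lemmas replace the rules of field arithmetic: the coefficients of these
  power series are themselves power series, hence do not form a field.
\<close>

lemma divide_kr_denom: "f / kr_denom n1 n2 = f * (1 / kr_denom n1 n2)"
proof -
  have "f / kr_denom n1 n2 * kr_denom n1 n2 = (f * (1 / kr_denom n1 n2)) * kr_denom n1 n2"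
    by (simp add: fps_divide_mult_const_1 kr_denom_const_1 mult.assoc)
  moreover have "kr_denom n1 n2 \<noteq> 0"
    using kr_denom_const_1[of n1 n2] by auto
  ultimately show ?thesis by simp
qed

lemma inverse_kr_denom_step:
  assumes "kr_denom n1' n2' = f * kr_denom n1 n2"
  shows "f * (1 / kr_denom n1' n2') = 1 / kr_denom n1 n2"
proof -
  have "(f * (1 / kr_denom n1' n2')) * kr_denom n1 n2 = 1 / kr_denom n1 n2 * kr_denom n1 n2"
    using fps_divide_mult_const_1[OF kr_denom_const_1, of 1]
    by (metis assms mult.assoc mult.commute)
  moreover have "kr_denom n1 n2 \<noteq> 0"
    using kr_denom_const_1[of n1 n2] by auto
  ultimately show ?thesis by simp
qed

lemma inverse_kr_denom_Suc_left:
  "(1 - q_var ^ Suc n1) * (1 / kr_denom (Suc n1) n2) = 1 / kr_denom n1 n2"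
  by (rule inverse_kr_denom_step) (simp add: kr_denom_def qpochhammer_def)

lemma inverse_kr_denom_Suc_right:
  "(1 - q_var ^ (3 * Suc n2)) * (1 / kr_denom n1 (Suc n2)) = 1 / kr_denom n1 n2"
  by (rule inverse_kr_denom_step) (simp add: kr_denom_def qpochhammer_def power_add power_mult)

lemma fps_nth_kr_term_eq_0:
  assumes "n < 3 * n2\<^sup>2 + b * n2 + n1\<^sup>2 + a * n1 + 3 * n1 * n2"
  shows "fps_nth (kr_term a b (n1, n2)) n = 0"
  using assms
  by (simp add: kr_term_def divide_kr_denom[of "_ * _"] mult.assoc q_var_def fps_X_power_mult_nth)

lemma kr_term_has_sum: "(kr_term a b has_sum kr_series a b) UNIV"
proof -
  have "finite {p. fps_nth (kr_term a b p) n \<noteq> 0}" for n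
  proof (rule finite_subset)
    show "{p. fps_nth (kr_term a b p) n \<noteq> 0} \<subseteq> {..n} \<times> {..n}"
    proof clarify
      fix n1 n2 assume "fps_nth (kr_term a b (n1, n2)) n \<noteq> 0"
      then have "3 * n2\<^sup>2 + b * n2 + n1\<^sup>2 + a * n1 + 3 * n1 * n2 \<le> n"
        using fps_nth_kr_term_eq_0 not_less by blast
      moreover have "n1 \<le> n1\<^sup>2" "n2 \<le> n2\<^sup>2"
        by (simp_all add: power2_eq_square)
      ultimately show "n1 \<in> {..n} \<and> n2 \<in> {..n}" by simp
    qed
  qed simp
  then have "(kr_term a b has_sum
      Abs_fps (\<lambda>n. \<Sum>p | p \<in> UNIV \<and> fps_nth (kr_term a b p) n \<noteq> 0. fps_nth (kr_term a b p) n)) UNIV"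
    by (intro has_sum_fpsI) auto
  then show ?thesis
    unfolding kr_series_def by (simp add: has_sum_iff)
qed

text \<open>
  The difference of corresponding terms of \<open>kr_series a b\<close> and \<open>kr_series (a + 1) b\<close> contains the
  factor \<open>1 - q^n1\<close>.  It vanishes for \<open>n1 = 0\<close>, and for \<open>n1 = n + 1\<close> it cancels against
  \<open>(q; q)_n1\<close>, which leaves a term of index \<open>n\<close> with shifted parameters.
\<close>

lemma kr_series_recurrence_left:
  "kr_series a b = kr_series (a + 1) b + q_var ^ (a + 1) * x_var * kr_series (a + 2) (b + 3)"
proof -
  \<comment> \<open>the shifted family, extended by zero to the whole index set\<close>
  define h where "h = (\<lambda>(n1, n2). case n1 of 0 \<Rightarrow> 0
    | Suc n \<Rightarrow> q_var ^ (a + 1) * x_var * kr_term (a + 2) (b + 3) (n, n2))"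
  have "((\<lambda>p. q_var ^ (a + 1) * x_var * kr_term (a + 2) (b + 3) p) has_sum
      q_var ^ (a + 1) * x_var * kr_series (a + 2) (b + 3)) UNIV"
    by (intro has_sum_cmult_right kr_term_has_sum)
  also have "(\<lambda>p. q_var ^ (a + 1) * x_var * kr_term (a + 2) (b + 3) p) = h \<circ> map_prod Suc id"
    by (auto simp: h_def fun_eq_iff)
  finally have "(h has_sum q_var ^ (a + 1) * x_var * kr_series (a + 2) (b + 3))
      (range (map_prod Suc id))"
    by (simp add: has_sum_reindex prod.inj_map del: o_apply)
  moreover have "h p = 0" if "p \<notin> range (map_prod Suc id)" for p
    using that by (cases p; cases "fst p") (auto simp: h_def image_iff)
  ultimately have h: "(h has_sum q_var ^ (a + 1) * x_var * kr_series (a + 2) (b + 3)) UNIV"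
    by (subst has_sum_cong_neutral[where T = "range (map_prod Suc id)" and g = h]) auto
  have "kr_term a b (n1, n2) = kr_term (a + 1) b (n1, n2) + h (n1, n2)" for n1 n2
  proof (cases n1)
    case 0
    then show ?thesis by (simp add: h_def kr_term_def)
  next
    case (Suc n)
    define c where "c = q_var ^ (3 * n2\<^sup>2 + b * n2 + n1\<^sup>2 + a * n1 + 3 * n1 * n2) * x_var ^ (2 * n2 + n1)"
    have "kr_term a b (n1, n2) - kr_term (a + 1) b (n1, n2) =
        c * ((1 - q_var ^ n1) * (1 / kr_denom n1 n2))"
      by (simp add: kr_term_def c_def divide_kr_denom[of "_ * _"] power_add algebra_simps)
    also have "\<dots> = c * (1 / kr_denom n n2)"
      unfolding Suc by (simp only: inverse_kr_denom_Suc_left)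
    also have "c = q_var ^ (a + 1) * x_var *
        (q_var ^ (3 * n2\<^sup>2 + (b + 3) * n2 + n\<^sup>2 + (a + 2) * n + 3 * n * n2) * x_var ^ (2 * n2 + n))"
    proof -
      have q: "3 * n2\<^sup>2 + b * n2 + n1\<^sup>2 + a * n1 + 3 * n1 * n2 =
          (a + 1) + (3 * n2\<^sup>2 + (b + 3) * n2 + n\<^sup>2 + (a + 2) * n + 3 * n * n2)"
        by (simp add: Suc power2_eq_square algebra_simps)
      have x: "2 * n2 + n1 = 1 + (2 * n2 + n)"
        by (simp add: Suc)
      show ?thesis
        unfolding c_def q x power_add[of _ "a + 1"] power_add[of _ 1] by (simp add: mult_ac)
    qed
    finally show ?thesis
      by (simp add: h_def Suc kr_term_def divide_kr_denom[of "_ * _"] algebra_simps)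
  qed
  then have "kr_term a b = (\<lambda>p. kr_term (a + 1) b p + h p)"
    by auto
  then have "(kr_term a b has_sum
      kr_series (a + 1) b + q_var ^ (a + 1) * x_var * kr_series (a + 2) (b + 3)) UNIV"
    using has_sum_add[OF kr_term_has_sum h, of "a + 1" b] by simp
  then show ?thesis
    using kr_term_has_sum has_sum_unique by blast
qed

text \<open>
  The same argument in the index \<open>n2\<close>: now the factor is \<open>1 - q^(3 n2)\<close>, and it cancels against
  \<open>(q^3; q^3)_n2\<close>.
\<close>

lemma kr_series_recurrence_right:
  "kr_series a b = kr_series a (b + 3) + q_var ^ (b + 3) * x_var\<^sup>2 * kr_series (a + 3) (b + 6)"
proof -
  \<comment> \<open>the shifted family, extended by zero to the whole index set\<close>
  define h where "h = (\<lambda>(n1, n2). case n2 of 0 \<Rightarrow> 0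
    | Suc n \<Rightarrow> q_var ^ (b + 3) * x_var\<^sup>2 * kr_term (a + 3) (b + 6) (n1, n))"
  have "((\<lambda>p. q_var ^ (b + 3) * x_var\<^sup>2 * kr_term (a + 3) (b + 6) p) has_sum
      q_var ^ (b + 3) * x_var\<^sup>2 * kr_series (a + 3) (b + 6)) UNIV"
    by (intro has_sum_cmult_right kr_term_has_sum)
  also have "(\<lambda>p. q_var ^ (b + 3) * x_var\<^sup>2 * kr_term (a + 3) (b + 6) p) = h \<circ> map_prod id Suc"
    by (auto simp: h_def fun_eq_iff)
  finally have "(h has_sum q_var ^ (b + 3) * x_var\<^sup>2 * kr_series (a + 3) (b + 6))
      (range (map_prod id Suc))"
    by (simp add: has_sum_reindex prod.inj_map del: o_apply)
  moreover have "h p = 0" if "p \<notin> range (map_prod id Suc)" for p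
    using that by (cases p; cases "snd p") (auto simp: h_def image_iff)
  ultimately have h: "(h has_sum q_var ^ (b + 3) * x_var\<^sup>2 * kr_series (a + 3) (b + 6)) UNIV"
    by (subst has_sum_cong_neutral[where T = "range (map_prod id Suc)" and g = h]) auto
  have "kr_term a b (n1, n2) = kr_term a (b + 3) (n1, n2) + h (n1, n2)" for n1 n2
  proof (cases n2)
    case 0
    then show ?thesis by (simp add: h_def kr_term_def)
  next
    case (Suc n)
    define c where "c = q_var ^ (3 * n2\<^sup>2 + b * n2 + n1\<^sup>2 + a * n1 + 3 * n1 * n2) * x_var ^ (2 * n2 + n1)"
    have "kr_term a b (n1, n2) - kr_term a (b + 3) (n1, n2) =
        c * ((1 - q_var ^ (3 * n2)) * (1 / kr_denom n1 n2))"
      by (simp add: kr_term_def c_def divide_kr_denom[of "_ * _"] power_add algebra_simps)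
    also have "\<dots> = c * (1 / kr_denom n1 n)"
      unfolding Suc by (simp only: inverse_kr_denom_Suc_right)
    also have "c = q_var ^ (b + 3) * x_var\<^sup>2 *
        (q_var ^ (3 * n\<^sup>2 + (b + 6) * n + n1\<^sup>2 + (a + 3) * n1 + 3 * n1 * n) * x_var ^ (2 * n + n1))"
    proof -
      have q: "3 * n2\<^sup>2 + b * n2 + n1\<^sup>2 + a * n1 + 3 * n1 * n2 =
          (b + 3) + (3 * n\<^sup>2 + (b + 6) * n + n1\<^sup>2 + (a + 3) * n1 + 3 * n1 * n)"
        by (simp add: Suc power2_eq_square algebra_simps)
      have x: "2 * n2 + n1 = 2 + (2 * n + n1)"
        by (simp add: Suc)
      show ?thesis
        unfolding c_def q x power_add[of _ "b + 3"] power_add[of _ 2] by (simp add: mult_ac)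
    qed
    finally show ?thesis
      by (simp add: h_def Suc kr_term_def divide_kr_denom[of "_ * _"] algebra_simps)
  qed
  then have "kr_term a b = (\<lambda>p. kr_term a (b + 3) p + h p)"
    by auto
  then have "(kr_term a b has_sum
      kr_series a (b + 3) + q_var ^ (b + 3) * x_var\<^sup>2 * kr_series (a + 3) (b + 6)) UNIV"
    using has_sum_add[OF kr_term_has_sum h, of a "b + 3"] by simp
  then show ?thesis
    using kr_term_has_sum has_sum_unique by blast
qed

lemma fps_nth_kr_series_small:
  assumes "n < a" "n < b"
  shows "fps_nth (kr_series a b) n = (if n = 0 then 1 else 0)"
proof -
  have 0: "fps_nth (kr_term a b p) n = 0" if "p \<noteq> (0, 0)" for p
  proof (cases p)
    case (Pair n1 n2)
    have "a \<le> a * n1 \<or> b \<le> b * n2" using that Pair by auto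
    then have "n < b * n2 + a * n1"
      using assms by linarith
    then show ?thesis unfolding Pair by (intro fps_nth_kr_term_eq_0) simp
  qed
  have "kr_term a b (0, 0) = 1"
    using fps_divide_mult_const_1[OF kr_denom_const_1[of 0 0], of 1]
    by (simp add: kr_term_def kr_denom_def qpochhammer_def)
  then have 1: "fps_nth (kr_term a b (0, 0)) n = (if n = 0 then 1 else 0)"
    by simp
  have "fps_nth (kr_series a b) n =
      (\<Sum>p | p \<in> UNIV \<and> fps_nth (kr_term a b p) n \<noteq> 0. fps_nth (kr_term a b p) n)"
    by (rule has_sum_fpsD(2)[OF kr_term_has_sum])
  also have "\<dots> = (\<Sum>p\<in>{(0, 0)}. fps_nth (kr_term a b p) n)"
    by (rule sum.mono_neutral_left) (use 0 in auto)
  finally show ?thesis by (simp add: 1)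
qed

text \<open>
  The parameters can be read off from the terms that start the series.  The terms with a single
  part add up to \<open>x q^(a+1) / (1 - q)\<close>, where the exponent \<open>a + 1\<close>
  should be the least possible part \<open>k\<close>.  The terms \<open>n1 = 0\<close>,
  \<open>n2 = 1\<close> give \<open>x^2 q^(b+3) / (1 - q^3)\<close>, where \<open>b + 3\<close> should be the least sum of two
  parts \<open>\<ge> k\<close> that differ by at most one: \<open>6j+6\<close>, \<open>6j+9\<close>, \<open>6j+12\<close> for
  \<open>k = 3j+3\<close>, \<open>3j+4\<close>, \<open>3j+5\<close>, attained by the pairs \<open>(3j+3, 3j+3)\<close>, \<open>(3j+4, 3j+5)\<close>,
  \<open>(3j+6, 3j+6)\<close>.
\<close>

lemma kr_system_series:
  "kr_system (\<lambda>k. kr_series (k - 1) (3 * (2 * (k div 3) + k mod 3 - 1)))"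
proof -
  define H where "H k = kr_series (k - 1) (3 * (2 * (k div 3) + k mod 3 - 1))" for k
  have H: "H (3*j+3) = kr_series (3*j+2) (6*j+3)"
    "H (3*j+4) = kr_series (3*j+3) (6*j+6)"
    "H (3*j+5) = kr_series (3*j+4) (6*j+9)"
    "H (3*j+6) = kr_series (3*j+5) (6*j+9)"
    "H (3*j+7) = kr_series (3*j+6) (6*j+12)"
    "H (3*j+8) = kr_series (3*j+7) (6*j+15)" for j
  proof -
    have "H (3*j+r) = kr_series (3*j+r - 1) (3 * (2 * (j + r div 3) + r mod 3 - 1))" for r
      by (simp add: H_def)
    from this[of 3] this[of 4] this[of 5] this[of 6] this[of 7] this[of 8]
    show "H (3*j+3) = kr_series (3*j+2) (6*j+3)"
      "H (3*j+4) = kr_series (3*j+3) (6*j+6)"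
      "H (3*j+5) = kr_series (3*j+4) (6*j+9)"
      "H (3*j+6) = kr_series (3*j+5) (6*j+9)"
      "H (3*j+7) = kr_series (3*j+6) (6*j+12)"
      "H (3*j+8) = kr_series (3*j+7) (6*j+15)"
      by (simp_all add: algebra_simps)
  qed
  have left: "kr_series a b = kr_series a' b + q_var ^ a' * x_var * kr_series a'' b''"
    if "a' = a + 1" "a'' = a + 2" "b'' = b + 3" for a b a' a'' b''
    using kr_series_recurrence_left[of a b] that by simp
  have right: "kr_series a b = kr_series a b' + q_var ^ b' * x_var\<^sup>2 * kr_series a'' b''"
    if "b' = b + 3" "a'' = a + 3" "b'' = b + 6" for a b b' a'' b''
    using kr_series_recurrence_right[of a b] that by simp
  have "H (3*j+3) = H (3*j+4) + q_var^(3*j+3) * x_var * H (3*j+5)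
            + q_var^(6*j+6) * x_var^2 * H (3*j+6)" for j
  proof -
    have "H (3*j+3) = kr_series (3*j+2) (6*j+6) + q_var^(6*j+6) * x_var^2 * H (3*j+6)"
      unfolding H by (rule right) simp_all
    also have "kr_series (3*j+2) (6*j+6) = H (3*j+4) + q_var^(3*j+3) * x_var * H (3*j+5)"
      unfolding H by (rule left) simp_all
    finally show ?thesis .
  qed
  moreover have "H (3*j+4) = H (3*j+5) + q_var^(3*j+4) * x_var * H (3*j+7)
            + q_var^(6*j+9) * x_var^2 * H (3*j+7) + q_var^(6*j+10) * x_var^2 * H (3*j+8)" for j
  proof -
    have "H (3*j+4) = kr_series (3*j+3) (6*j+9) + q_var^(6*j+9) * x_var^2 * H (3*j+7)"
      unfolding H by (rule right) simp_all
    also have "kr_series (3*j+3) (6*j+9) =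
        H (3*j+5) + q_var^(3*j+4) * x_var * kr_series (3*j+5) (6*j+12)"
      unfolding H by (rule left) simp_all
    also have "kr_series (3*j+5) (6*j+12) = H (3*j+7) + q_var^(3*j+6) * x_var * H (3*j+8)"
      unfolding H by (rule left) simp_all
    also have "q_var^(3*j+4) * x_var * (H (3*j+7) + q_var^(3*j+6) * x_var * H (3*j+8)) =
        q_var^(3*j+4) * x_var * H (3*j+7) + q_var^((3*j+4) + (3*j+6)) * x_var^2 * H (3*j+8)"
      unfolding power_add[of _ "3*j+4" "3*j+6"] by (simp only: power2_eq_square distrib_left mult_ac)
    also have "(3*j+4) + (3*j+6) = 6*j+10"
      by simp
    finally show ?thesis
      by (simp only: add_ac)
  qed
  moreover have "H (3*j+5) = H (3*j+6) + q_var^(3*j+5) * x_var * H (3*j+7)" for j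
    unfolding H by (rule left) simp_all
  moreover have "fps_nth (H k) n = (if n = 0 then 1 else 0)" if "3 \<le> k" "n + 1 < k" for k n
  proof -
    have "k \<le> 3 * (2 * (k div 3) + k mod 3 - 1)"
    proof -
      have "k = 3 * (k div 3) + k mod 3" "1 \<le> k div 3"
        using that by (simp_all add: Suc_le_eq div_greater_zero_iff)
      then show ?thesis by linarith
    qed
    with that show ?thesis unfolding H_def by (intro fps_nth_kr_series_small) auto
  qed
  ultimately show ?thesis
    unfolding H_def[symmetric] kr_system_def by blast
qed

section \<open>Removing the smallest parts of a partition\<close>

definition kr_admissible :: "nat list \<Rightarrow> bool" where
  "kr_admissible ps \<longleftrightarrow> sorted ps \<and> diff_at_distance 3 2 ps \<and> close_parts_sum_dvd 3 ps"

definition kr_partitions :: "nat \<Rightarrow> nat list set" where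
  "kr_partitions k = {ps. kr_admissible ps \<and> (\<forall>p\<in>set ps. k \<le> p)}"

lemma all_nat_iff: "(\<forall>j::nat. P j) \<longleftrightarrow> P 0 \<and> (\<forall>j. P (Suc j))"
  by (metis nat.exhaust)

lemma kr_admissible_Nil [simp]: "kr_admissible []"
  by (simp add: kr_admissible_def diff_at_distance_def close_parts_sum_dvd_def)

lemma kr_admissible_singleton [simp]: "kr_admissible [a]"
  by (simp add: kr_admissible_def diff_at_distance_def close_parts_sum_dvd_def)

lemma kr_admissible_Cons_Cons:
  "kr_admissible (a # b # ps) \<longleftrightarrow> a \<le> b \<and> (b \<le> a + 1 \<longrightarrow> 3 dvd a + b) \<and>
     (ps \<noteq> [] \<longrightarrow> a + 3 \<le> hd ps) \<and> kr_admissible (b # ps)"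
proof -
  have "diff_at_distance 3 2 (a # b # ps) \<longleftrightarrow>
      (ps \<noteq> [] \<longrightarrow> a + 3 \<le> hd ps) \<and> diff_at_distance 3 2 (b # ps)"
    unfolding diff_at_distance_def by (subst all_nat_iff) (cases ps; simp)
  moreover have "close_parts_sum_dvd 3 (a # b # ps) \<longleftrightarrow>
      (b \<le> a + 1 \<longrightarrow> 3 dvd a + b) \<and> close_parts_sum_dvd 3 (b # ps)"
    unfolding close_parts_sum_dvd_def by (subst all_nat_iff) simp
  moreover have "sorted (a # b # ps) \<longleftrightarrow> a \<le> b \<and> sorted (b # ps)"
    by auto
  ultimately show ?thesis
    by (simp add: kr_admissible_def del: sorted_wrt.simps) metis
qed

lemma kr_admissible_ConsD: "kr_admissible (a # ps) \<Longrightarrow> kr_admissible ps"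
  by (cases ps) (simp_all add: kr_admissible_Cons_Cons)

lemma in_kr_partitions_iff:
  "ps \<in> kr_partitions k \<longleftrightarrow> kr_admissible ps \<and> (ps \<noteq> [] \<longrightarrow> k \<le> hd ps)"
  by (cases ps) (auto simp: kr_partitions_def kr_admissible_def)

text \<open>
  Two equal successive parts must be divisible by 3.  So if \<open>m\<close> is not divisible by 3, the value
  \<open>m\<close> occurs at most once.  This is what turns a bound on the second part into a better bound
  on the third one below.
\<close>

lemma kr_admissible_tl:
  assumes "kr_admissible (a # ps)" "m \<le> a" "\<not> 3 dvd m"
  shows "ps \<in> kr_partitions (m + 1)"
proof (cases ps)
  case Nil
  then show ?thesis by (simp add: in_kr_partitions_iff)
next
  case (Cons b qs)
  have *: "a \<le> b" "b \<le> a + 1 \<longrightarrow> 3 dvd a + b"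
    using assms(1) by (simp_all add: Cons kr_admissible_Cons_Cons)
  have "m + 1 \<le> b"
  proof (rule ccontr)
    assume "\<not> m + 1 \<le> b"
    with *(1) assms(2) have "a = m" "b = m" by simp_all
    with * have "3 dvd m + m" by simp
    with assms(3) show False by presburger
  qed
  then show ?thesis
    using kr_admissible_ConsD[OF assms(1)] by (simp add: in_kr_partitions_iff Cons)
qed

text \<open>
  The new part is too far from its successor for the divisibility condition to apply, and the part
  at distance two is at least as large as the successor.
\<close>

lemma kr_admissible_Cons_if_far:
  assumes "ps \<in> kr_partitions (a + 3)"
  shows "kr_admissible (a # ps)"
proof (cases ps)
  case (Cons b qs)
  have "qs \<noteq> [] \<longrightarrow> b \<le> hd qs"
    using assms by (cases qs) (auto simp: Cons in_kr_partitions_iff kr_admissible_Cons_Cons)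
  then show ?thesis
    using assms by (auto simp: Cons in_kr_partitions_iff kr_admissible_Cons_Cons)
qed simp

text \<open>
  The parts \<open>3j+5\<close> and \<open>3j+6\<close> cannot follow a part \<open>3j+5\<close>, as the sums \<open>6j+10\<close> and \<open>6j+11\<close> are
  not divisible by 3.  Conversely, if all other parts are at least \<open>3j+7\<close>, then the condition at
  distance two is automatic, since \<open>3j+7\<close> is not repeated.
\<close>

lemma kr_admissible_2_mod_3:
  "kr_admissible ((3*j+5) # ps) \<longleftrightarrow> ps \<in> kr_partitions (3*j+7)"
proof (cases ps)
  case (Cons b qs)
  have 1: "3*j+5 \<le> b \<and> (b \<le> 3*j+5+1 \<longrightarrow> 3 dvd 3*j+5+b) \<longleftrightarrow> 3*j+7 \<le> b"
    by presburger
  have 2: "qs \<noteq> [] \<longrightarrow> 3*j+5+3 \<le> hd qs" if "3*j+7 \<le> b" "kr_admissible (b # qs)"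
  proof -
    have "\<not> 3 dvd 3*j+7" by presburger
    from kr_admissible_tl[OF that(2,1) this] show ?thesis by (simp add: in_kr_partitions_iff)
  qed
  show ?thesis
    unfolding Cons kr_admissible_Cons_Cons in_kr_partitions_iff list.sel using 1 2 by blast
qed (simp add: in_kr_partitions_iff)

text \<open>
  After a part \<open>3j+3\<close> the next part is either a second \<open>3j+3\<close>, and then all further parts are at
  least \<open>3j+6\<close>, or it is at least \<open>3j+5\<close>; in the latter case the condition at distance two is
  automatic, since \<open>3j+5\<close> is not repeated.
\<close>

lemma kr_admissible_0_mod_3:
  "kr_admissible ((3*j+3) # ps) \<longleftrightarrow> ps \<in> kr_partitions (3*j+5) \<or>
     (\<exists>qs\<in>kr_partitions (3*j+6). ps = (3*j+3) # qs)"
proof (cases ps)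
  case (Cons b qs)
  have 1: "3*j+3 \<le> b \<and> (b \<le> 3*j+3+1 \<longrightarrow> 3 dvd 3*j+3+b) \<longleftrightarrow> b = 3*j+3 \<or> 3*j+5 \<le> b"
    by presburger
  have 2: "qs \<noteq> [] \<longrightarrow> 3*j+3+3 \<le> hd qs" if "3*j+5 \<le> b" "kr_admissible (b # qs)"
  proof -
    have "\<not> 3 dvd 3*j+5" by presburger
    from kr_admissible_tl[OF that(2,1) this] show ?thesis by (simp add: in_kr_partitions_iff)
  qed
  have 3: "(qs \<noteq> [] \<longrightarrow> 3*j+3+3 \<le> hd qs) \<and> kr_admissible (b # qs) \<longleftrightarrow> qs \<in> kr_partitions (3*j+6)"
    if "b = 3*j+3"
    using kr_admissible_Cons_if_far[of qs b] kr_admissible_ConsD[of b qs] that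
    by (auto simp: in_kr_partitions_iff)
  have "kr_admissible ((3*j+3) # ps) \<longleftrightarrow>
      3*j+5 \<le> b \<and> kr_admissible (b # qs) \<or> b = 3*j+3 \<and> qs \<in> kr_partitions (3*j+6)"
    unfolding Cons kr_admissible_Cons_Cons using 1 2 3 by blast
  then show ?thesis
    by (auto simp: Cons in_kr_partitions_iff)
qed (simp add: in_kr_partitions_iff)

text \<open>
  After a part \<open>3j+4\<close> the next part can be \<open>3j+5\<close>, the only admissible close partner, or \<open>3j+6\<close>,
  or something larger.  The middle case needs its own summand: \<open>3j+6\<close> could otherwise be repeated,
  which the condition at distance two excludes here, and the part after it cannot be \<open>3j+7\<close>.
\<close>

lemma kr_admissible_1_mod_3:
  "kr_admissible ((3*j+4) # ps) \<longleftrightarrow> ps \<in> kr_partitions (3*j+7) \<or>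
     (\<exists>qs\<in>kr_partitions (3*j+7). ps = (3*j+5) # qs) \<or>
     (\<exists>qs\<in>kr_partitions (3*j+8). ps = (3*j+6) # qs)"
proof (cases ps)
  case (Cons b qs)
  have 1: "3*j+4 \<le> b \<and> (b \<le> 3*j+4+1 \<longrightarrow> 3 dvd 3*j+4+b) \<longleftrightarrow>
      3*j+7 \<le> b \<or> b = 3*j+5 \<or> b = 3*j+6"
    by presburger
  have 2: "qs \<noteq> [] \<longrightarrow> 3*j+4+3 \<le> hd qs" if "3*j+7 \<le> b" "kr_admissible (b # qs)"
    using that by (cases qs) (auto simp: kr_admissible_Cons_Cons)
  have 3: "(qs \<noteq> [] \<longrightarrow> 3*j+4+3 \<le> hd qs) \<and> kr_admissible (b # qs) \<longleftrightarrow> qs \<in> kr_partitions (3*j+7)"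
    if "b = 3*j+5"
    using kr_admissible_2_mod_3[of j qs] that by (auto simp: in_kr_partitions_iff)
  have "kr_admissible ((3*j+6) # qs) \<longleftrightarrow>
      qs \<in> kr_partitions (3*j+8) \<or> (\<exists>rs\<in>kr_partitions (3*j+9). qs = (3*j+6) # rs)"
    using kr_admissible_0_mod_3[of "j+1" qs] by (simp add: algebra_simps)
  then have 4: "(qs \<noteq> [] \<longrightarrow> 3*j+4+3 \<le> hd qs) \<and> kr_admissible (b # qs) \<longleftrightarrow> qs \<in> kr_partitions (3*j+8)"
    if "b = 3*j+6"
    using that by (auto simp: in_kr_partitions_iff)
  have "kr_admissible ((3*j+4) # ps) \<longleftrightarrow> 3*j+7 \<le> b \<and> kr_admissible (b # qs) \<or>
      b = 3*j+5 \<and> qs \<in> kr_partitions (3*j+7) \<or> b = 3*j+6 \<and> qs \<in> kr_partitions (3*j+8)"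
    unfolding Cons kr_admissible_Cons_Cons using 1 2 3 4 by blast
  then show ?thesis
    by (auto simp: Cons in_kr_partitions_iff)
qed (simp add: in_kr_partitions_iff)

lemma kr_partitions_split_smallest:
  assumes "l = k + 1"
  shows "kr_partitions k = kr_partitions l \<union> {k # qs | qs. kr_admissible (k # qs)}"
proof -
  have "ps \<in> kr_partitions k \<longleftrightarrow>
      ps \<in> kr_partitions l \<or> (\<exists>qs. ps = k # qs \<and> kr_admissible (k # qs))" for ps
    by (cases ps; cases "hd ps = k") (auto simp: in_kr_partitions_iff assms)
  then show ?thesis by blast
qed

lemma kr_partitions_0_mod_3:
  "kr_partitions (3*j+3) = kr_partitions (3*j+4) \<union> (@) [3*j+3] ` kr_partitions (3*j+5)
     \<union> (@) [3*j+3, 3*j+3] ` kr_partitions (3*j+6)"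
  by (subst kr_partitions_split_smallest[of "3*j+4"]) (auto simp: kr_admissible_0_mod_3)

lemma kr_partitions_1_mod_3:
  "kr_partitions (3*j+4) = kr_partitions (3*j+5) \<union> (@) [3*j+4] ` kr_partitions (3*j+7)
     \<union> (@) [3*j+4, 3*j+5] ` kr_partitions (3*j+7) \<union> (@) [3*j+4, 3*j+6] ` kr_partitions (3*j+8)"
  by (subst kr_partitions_split_smallest[of "3*j+5"]) (auto simp: kr_admissible_1_mod_3)

lemma kr_partitions_2_mod_3:
  "kr_partitions (3*j+5) = kr_partitions (3*j+6) \<union> (@) [3*j+5] ` kr_partitions (3*j+7)"
  by (subst kr_partitions_split_smallest[of "3*j+6"]) (auto simp: kr_admissible_2_mod_3)

section \<open>The generating function of the partitions\<close>

definition kr_weight :: "nat list \<Rightarrow> rat fps fps" where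
  "kr_weight ps = q_var ^ sum_list ps * x_var ^ length ps"

definition kr_gf :: "nat \<Rightarrow> rat fps fps" where
  "kr_gf k = infsum kr_weight (kr_partitions k)"

lemma fps_nth_kr_weight:
  "fps_nth (kr_weight ps) n = (if sum_list ps = n then fps_X ^ length ps else 0)"
  by (simp add: kr_weight_def q_var_def x_var_def fps_X_power_mult_nth)

lemma finite_kr_partitions_sum_list:
  assumes "0 < k"
  shows "finite {ps \<in> kr_partitions k. sum_list ps = n}"
proof (rule finite_subset)
  show "{ps \<in> kr_partitions k. sum_list ps = n} \<subseteq> {ps. set ps \<subseteq> {..n} \<and> length ps \<le> n}"
  proof clarify
    fix ps assume ps: "ps \<in> kr_partitions k"
    have "sum_list (map (\<lambda>_. 1) ps) \<le> sum_list (map (\<lambda>p. p) ps)"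
      using ps assms by (intro sum_list_mono) (force simp: kr_partitions_def)
    then have "length ps \<le> sum_list ps"
      by (simp add: sum_list_triv)
    then show "set ps \<subseteq> {..sum_list ps} \<and> length ps \<le> sum_list ps"
      by (auto intro: member_le_sum_list)
  qed
qed (simp add: finite_lists_length_le)

lemma kr_gf_has_sum:
  assumes "0 < k"
  shows "(kr_weight has_sum kr_gf k) (kr_partitions k)"
proof -
  have "finite {ps \<in> kr_partitions k. fps_nth (kr_weight ps) n \<noteq> 0}" for n
    by (rule finite_subset[OF _ finite_kr_partitions_sum_list[OF assms, of n]])
      (auto simp: fps_nth_kr_weight split: if_splits)
  then have "(kr_weight has_sum Abs_fps (\<lambda>n. \<Sum>ps | ps \<in> kr_partitions k \<and>
      fps_nth (kr_weight ps) n \<noteq> 0. fps_nth (kr_weight ps) n)) (kr_partitions k)"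
    by (intro has_sum_fpsI) auto
  then show ?thesis
    unfolding kr_gf_def by (simp add: has_sum_iff)
qed

lemma kr_weight_has_sum_append:
  assumes "0 < k"
  shows "(kr_weight has_sum kr_weight xs * kr_gf k) ((@) xs ` kr_partitions k)"
proof -
  have "((\<lambda>ps. kr_weight xs * kr_weight ps) has_sum kr_weight xs * kr_gf k) (kr_partitions k)"
    by (intro has_sum_cmult_right kr_gf_has_sum assms)
  also have "(\<lambda>ps. kr_weight xs * kr_weight ps) = kr_weight \<circ> (@) xs"
    by (simp add: fun_eq_iff kr_weight_def power_add)
  finally show ?thesis
    by (subst has_sum_reindex) (auto simp: inj_on_def simp del: o_apply)
qed

lemma kr_system_gf: "kr_system kr_gf"
proof -
  have unique: "kr_gf k = s" if "(kr_weight has_sum s) (kr_partitions k)" "0 < k" for k s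
    using that kr_gf_has_sum has_sum_unique by blast
  have hd: "ps \<noteq> [] \<Longrightarrow> k \<le> hd ps" if "ps \<in> kr_partitions k" for ps k
    using that in_kr_partitions_iff by blast
  have "kr_gf (3*j+3) = kr_gf (3*j+4) + q_var^(3*j+3) * x_var * kr_gf (3*j+5)
            + q_var^(6*j+6) * x_var^2 * kr_gf (3*j+6)" for j
  proof -
    have "(kr_weight has_sum kr_gf (3*j+4) + kr_weight [3*j+3] * kr_gf (3*j+5)
        + kr_weight [3*j+3, 3*j+3] * kr_gf (3*j+6)) (kr_partitions (3*j+3))"
      unfolding kr_partitions_0_mod_3
      by (intro has_sum_Un_disjoint kr_weight_has_sum_append kr_gf_has_sum)
        (auto dest!: hd)
    from unique[OF this] show ?thesis
      by (simp add: kr_weight_def power2_eq_square)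
  qed
  moreover have "kr_gf (3*j+4) = kr_gf (3*j+5) + q_var^(3*j+4) * x_var * kr_gf (3*j+7)
            + q_var^(6*j+9) * x_var^2 * kr_gf (3*j+7) + q_var^(6*j+10) * x_var^2 * kr_gf (3*j+8)" for j
  proof -
    have "(kr_weight has_sum kr_gf (3*j+5) + kr_weight [3*j+4] * kr_gf (3*j+7)
        + kr_weight [3*j+4, 3*j+5] * kr_gf (3*j+7) + kr_weight [3*j+4, 3*j+6] * kr_gf (3*j+8))
        (kr_partitions (3*j+4))"
      unfolding kr_partitions_1_mod_3
      by (intro has_sum_Un_disjoint kr_weight_has_sum_append kr_gf_has_sum)
        (auto dest!: hd)
    from unique[OF this] show ?thesis
      by (simp add: kr_weight_def power2_eq_square)
  qed
  moreover have "kr_gf (3*j+5) = kr_gf (3*j+6) + q_var^(3*j+5) * x_var * kr_gf (3*j+7)" for j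
  proof -
    have "(kr_weight has_sum kr_gf (3*j+6) + kr_weight [3*j+5] * kr_gf (3*j+7))
        (kr_partitions (3*j+5))"
      unfolding kr_partitions_2_mod_3
      by (intro has_sum_Un_disjoint kr_weight_has_sum_append kr_gf_has_sum)
        (auto dest!: hd)
    from unique[OF this] show ?thesis
      by (simp add: kr_weight_def)
  qed
  moreover have "fps_nth (kr_gf k) n = (if n = 0 then 1 else 0)" if "n + 1 < k" for k n
  proof -
    have "fps_nth (kr_gf k) n = (\<Sum>ps | ps \<in> kr_partitions k \<and> fps_nth (kr_weight ps) n \<noteq> 0.
        fps_nth (kr_weight ps) n)"
      using that by (intro has_sum_fpsD(2) kr_gf_has_sum) simp
    also have "\<dots> = (\<Sum>ps\<in>{[]}. fps_nth (kr_weight ps) n)"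
    proof (rule sum.mono_neutral_left)
      have "k \<le> sum_list ps" if "ps \<in> kr_partitions k" "ps \<noteq> []" for ps
        using hd[OF that] by (cases ps) (use that in auto)
      with that show "{ps \<in> kr_partitions k. fps_nth (kr_weight ps) n \<noteq> 0} \<subseteq> {[]}"
        by (force simp: fps_nth_kr_weight split: if_splits)
    qed (auto simp: in_kr_partitions_iff)
    finally show ?thesis by (simp add: fps_nth_kr_weight)
  qed
  ultimately show ?thesis
    unfolding kr_system_def by blast
qed

text \<open>
  The partitions are grouped by their sum and their number of parts.
\<close>

lemma kr3_has_sum:
  "((\<lambda>(n, m). of_nat (kr3 n m) * q_var ^ n * x_var ^ m) has_sum kr_gf 3) UNIV"
proof -
  define B where "B p = {ps \<in> kr_partitions 3. sum_list ps = fst p \<and> length ps = snd p}"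
    for p :: "nat \<times> nat"
  have kr3: "kr3 n m = card (B (n, m))" for n m
    unfolding kr3_def B_def
    by (rule arg_cong[where f = card]) (force simp: partition_into_def kr_partitions_def kr_admissible_def)
  have "finite (B p)" for p
    by (rule finite_subset[OF _ finite_kr_partitions_sum_list[of 3 "fst p"]]) (auto simp: B_def)
  then have inner: "((\<lambda>ps. kr_weight (snd (p, ps))) has_sum
      (case p of (n, m) \<Rightarrow> of_nat (kr3 n m) * q_var ^ n * x_var ^ m)) (B p)" for p
    by (intro has_sum_finiteI) (auto simp: kr3 B_def kr_weight_def split: prod.splits)
  have "bij_betw snd (Sigma UNIV B) (kr_partitions 3)"
    by (rule bij_betwI[where g = "\<lambda>ps. ((sum_list ps, length ps), ps)"]) (auto simp: B_def)
  then have "((\<lambda>z. kr_weight (snd z)) has_sum kr_gf 3) (Sigma UNIV B)"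
    using kr_gf_has_sum[of 3] by (subst has_sum_reindex_bij_betw) simp_all
  then show ?thesis
    by (rule has_sum_SigmaD[where f = "\<lambda>z. kr_weight (snd z)"]) (rule inner)
qed

theorem theorem9:
  shows "(\<lambda>(n, m). of_nat (kr3 n m) * q_var ^ n * x_var ^ m) summable_on (UNIV :: (nat \<times> nat) set) \<and>
    (\<lambda>(n1, n2).
        q_var ^ (3 * n2\<^sup>2 + 3 * n2 + n1\<^sup>2 + 2 * n1 + 3 * n1 * n2) * x_var ^ (2 * n2 + n1) /
        (qpochhammer q_var q_var n1 * qpochhammer (q_var ^ 3) (q_var ^ 3) n2))
      summable_on (UNIV :: (nat \<times> nat) set) \<and>
    (\<Sum>\<^sub>\<infinity>(n, m)\<in>(UNIV :: (nat \<times> nat) set). of_nat (kr3 n m) * q_var ^ n * x_var ^ m) =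
    (\<Sum>\<^sub>\<infinity>(n1, n2)\<in>(UNIV :: (nat \<times> nat) set).
        q_var ^ (3 * n2\<^sup>2 + 3 * n2 + n1\<^sup>2 + 2 * n1 + 3 * n1 * n2) * x_var ^ (2 * n2 + n1) /
        (qpochhammer q_var q_var n1 * qpochhammer (q_var ^ 3) (q_var ^ 3) n2))"
proof -
  have "kr_gf 3 = kr_series 2 3"
    using kr_system_unique[OF kr_system_gf kr_system_series, of 3] by simp
  then have "((\<lambda>(n1, n2).
        q_var ^ (3 * n2\<^sup>2 + 3 * n2 + n1\<^sup>2 + 2 * n1 + 3 * n1 * n2) * x_var ^ (2 * n2 + n1) /
        (qpochhammer q_var q_var n1 * qpochhammer (q_var ^ 3) (q_var ^ 3) n2)) has_sum kr_gf 3) UNIV"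
    using kr_term_has_sum[of 2 3] unfolding kr_term_def kr_denom_def by (simp only:)
  note sums = kr3_has_sum this
  show ?thesis
    by (intro conjI sums[THEN has_sum_imp_summable]) (simp only: sums[THEN infsumI])
qed

end
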